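(* For every $\varepsilon \in (0,\frac{1}{2})$ and every function $f:\{0,1\}^n\to\{\pm 1\}$ computable by a decision tree of size $s$, regardless of how ties are broken in $\textsc{BuildTopDownDT}$, we have $\textsc{TopDownDTSize}(f,\varepsilon) \le s^{O(\log(s/\varepsilon)\log(1/\varepsilon))}$.
   Context: The size of a decision tree is its number of leaves; logarithms are base 2. The influence of variable $i$ on $g:\{0,1\}^n\to\{\pm1\}$ is $\mathrm{Inf}_i(g)=\Pr_{\mathbf{x}}[g(\mathbf{x})\ne g(\mathbf{x}^{\oplus i})]$, with $\mathbf{x}$ uniform on $\{0,1\}^n$ and $\mathbf{x}^{\oplus i}$ denoting $\mathbf{x}$ with its $i$-th coordinate flipped. A bare tree is a decision tree with unlabeled leaves. For a leaf $\ell$ of a bare tree, $f_\ell$ denotes the restriction of $f$ by the path to $\ell$, and $|\ell|$ is the depth of $\ell$. The $f$-completion of a bare tree labels each leaf $\ell$ by $\mathrm{sign}(\mathbb{E}[f_\ell(\mathbf{x})])$. A tree $T$ is an $\varepsilon$-approximation of $f$ if $\Pr_{\mathbf{x}}[T(\mathbf{x})\neq f(\mathbf{x})]\le\varepsilon$. The algorithm $\textsc{BuildTopDownDT}(f,\varepsilon)$: start with the empty bare tree $T^\circ$ (a single leaf); while the $f$-completion of $T^\circ$ is not an $\varepsilon$-approximation of $f$, for every leaf $\ell$ let $x_{i(\ell)}$ be a variable maximizing $\mathrm{Inf}_{i}(f_\ell)$ and set $\mathrm{score}(\ell)=2^{-|\ell|}\mathrm{Inf}_{i(\ell)}(f_\ell)$;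 replace a leaf $\ell^\star$ of highest score by a query to $x_{i(\ell^\star)}$ (with two leaf children). Output the $f$-completion of $T^\circ$. $\textsc{TopDownDTSize}(f,\varepsilon)$ is the size of the output tree. *)

theory Defs
  imports "HOL-Probability.Probability"
begin

text \<open>The cube \<open>{0,1}\<^sup>n\<close> has the explicit carrier \<open>cube n\<close>, rather than a finite index type, so that
  a statement can assert the existence of one constant that works for all \<open>n\<close>. A function
  on the cube is only ever meaningful on this carrier.\<close>

definition cube :: "nat \<Rightarrow> (nat \<Rightarrow> bool) set" where
  "cube n = {..<n} \<rightarrow>\<^sub>E UNIV"

abbreviation uniform_cube :: "nat \<Rightarrow> (nat \<Rightarrow> bool) pmf" where
  "uniform_cube n \<equiv> pmf_of_set (cube n)"

definition flip :: "nat \<Rightarrow> (nat \<Rightarrow> bool) \<Rightarrow> (nat \<Rightarrow> bool)" where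
  "flip i x = x(i := \<not> x i)"

definition influence :: "nat \<Rightarrow> nat \<Rightarrow> ((nat \<Rightarrow> bool) \<Rightarrow> real) \<Rightarrow> real" where
  "influence n i g = measure_pmf.prob (uniform_cube n) {x. g x \<noteq> g (flip i x)}"

text \<open>In \<open>Query i l r\<close> the subtree \<open>l\<close> is taken if coordinate \<open>i\<close> is 0 and \<open>r\<close> if it is 1.\<close>

datatype 'a dtree = Leaf 'a | Query nat "'a dtree" "'a dtree"

type_synonym bare_tree = "unit dtree"

primrec dt_size :: "'a dtree \<Rightarrow> nat" where
  "dt_size (Leaf a) = 1"
| "dt_size (Query i l r) = dt_size l + dt_size r"

primrec dt_vars :: "'a dtree \<Rightarrow> nat set" where
  "dt_vars (Leaf a) = {}"
| "dt_vars (Query i l r) = {i} \<union> dt_vars l \<union> dt_vars r"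

primrec dt_eval :: "'a dtree \<Rightarrow> (nat \<Rightarrow> bool) \<Rightarrow> 'a" where
  "dt_eval (Leaf a) x = a"
| "dt_eval (Query i l r) x = (if x i then dt_eval r x else dt_eval l x)"

definition computable_by_dt_of_size :: "nat \<Rightarrow> ((nat \<Rightarrow> bool) \<Rightarrow> real) \<Rightarrow> nat \<Rightarrow> bool" where
  "computable_by_dt_of_size n f s \<longleftrightarrow>
     (\<exists>T. dt_vars T \<subseteq> {..<n} \<and> set_dtree T \<subseteq> {-1, 1} \<and> dt_size T = s \<and>
          (\<forall>x\<in>cube n. dt_eval T x = f x))"

text \<open>A leaf is identified with the root-to-leaf path leading to it, recorded as the list of
  queried variables with their answers; its depth is the length of that list.\<close>

type_synonym path = "(nat \<times> bool) list"

primrec leaves :: "'a dtree \<Rightarrow> path set" where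
  "leaves (Leaf a) = {[]}"
| "leaves (Query i l r) = (#) (i, False) ` leaves l \<union> (#) (i, True) ` leaves r"

text \<open>The restricted function is kept as a function on the whole cube that ignores the fixed
  coordinates. This changes neither its expectation nor the influences of the free
  variables, and the fixed variables get influence 0.\<close>

primrec restrict_path :: "((nat \<Rightarrow> bool) \<Rightarrow> real) \<Rightarrow> path \<Rightarrow> (nat \<Rightarrow> bool) \<Rightarrow> real" where
  "restrict_path f [] = f"
| "restrict_path f (q # p) = restrict_path (\<lambda>x. f (x(fst q := snd q))) p"

text \<open>Unlike \<^const>\<open>sgn\<close>, this takes values in \<open>{-1, 1}\<close>. At a leaf with expectation 0 both labels
  err on exactly half of the inputs, so the convention for 0 does not affect the algorithm.\<close>

definition sign_pm :: "real \<Rightarrow> real" where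
  "sign_pm v = (if v \<ge> 0 then 1 else -1)"

primrec label_leaves :: "(path \<Rightarrow> 'b) \<Rightarrow> 'a dtree \<Rightarrow> 'b dtree" where
  "label_leaves L (Leaf a) = Leaf (L [])"
| "label_leaves L (Query i l r) =
     Query i (label_leaves (\<lambda>p. L ((i, False) # p)) l) (label_leaves (\<lambda>p. L ((i, True) # p)) r)"

definition completion :: "nat \<Rightarrow> ((nat \<Rightarrow> bool) \<Rightarrow> real) \<Rightarrow> bare_tree \<Rightarrow> real dtree" where
  "completion n f =
     label_leaves (\<lambda>p. sign_pm (measure_pmf.expectation (uniform_cube n) (restrict_path f p)))"

definition is_approximation ::
  "nat \<Rightarrow> real \<Rightarrow> ((nat \<Rightarrow> bool) \<Rightarrow> real) \<Rightarrow> real dtree \<Rightarrow> bool" where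
  "is_approximation n \<epsilon> f T \<longleftrightarrow>
     measure_pmf.prob (uniform_cube n) {x. dt_eval T x \<noteq> f x} \<le> \<epsilon>"

text \<open>\<open>expand_leaf T p j\<close> is only meaningful for \<open>p \<in> leaves T\<close>.\<close>

fun expand_leaf :: "bare_tree \<Rightarrow> path \<Rightarrow> nat \<Rightarrow> bare_tree" where
  "expand_leaf (Leaf a) p j = Query j (Leaf ()) (Leaf ())"
| "expand_leaf (Query i l r) [] j = Query i l r"
| "expand_leaf (Query i l r) (q # p) j =
     (if snd q then Query i l (expand_leaf r p j) else Query i (expand_leaf l p j) r)"

definition score :: "nat \<Rightarrow> ((nat \<Rightarrow> bool) \<Rightarrow> real) \<Rightarrow> path \<Rightarrow> nat \<Rightarrow> real" where
  "score n f p i = influence n i (restrict_path f p) / 2 ^ length p"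

text \<open>One iteration of the while loop, including its guard. It is a relation, so that every way
  of breaking ties, both among variables (the choice of \<open>v\<close>) and among leaves (the choice of
  \<open>q\<close>), is covered, independently in each iteration.\<close>

definition top_down_step ::
  "nat \<Rightarrow> ((nat \<Rightarrow> bool) \<Rightarrow> real) \<Rightarrow> real \<Rightarrow> bare_tree \<Rightarrow> bare_tree \<Rightarrow> bool" where
  "top_down_step n f \<epsilon> T T' \<longleftrightarrow>
     \<not> is_approximation n \<epsilon> f (completion n f T) \<and>
     (\<exists>v q. (\<forall>p\<in>leaves T.
               is_arg_max (\<lambda>i. influence n i (restrict_path f p)) (\<lambda>i. i < n) (v p)) \<and>
            is_arg_max (\<lambda>p. score n f p (v p)) (\<lambda>p. p \<in> leaves T) q \<and>
            T' = expand_leaf T q (v q))"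

definition top_down_output ::
  "nat \<Rightarrow> ((nat \<Rightarrow> bool) \<Rightarrow> real) \<Rightarrow> real \<Rightarrow> real dtree \<Rightarrow> bool" where
  "top_down_output n f \<epsilon> D \<longleftrightarrow>
     (\<exists>T. (top_down_step n f \<epsilon>)\<^sup>*\<^sup>* (Leaf ()) T \<and>
          D = completion n f T \<and> is_approximation n \<epsilon> f D)"

text \<open>Every run is finite and can only stop at an output, however ties are broken.\<close>

definition top_down_terminates :: "nat \<Rightarrow> ((nat \<Rightarrow> bool) \<Rightarrow> real) \<Rightarrow> real \<Rightarrow> bool" where
  "top_down_terminates n f \<epsilon> \<longleftrightarrow>
     (\<nexists>R. R 0 = Leaf () \<and> (\<forall>t. top_down_step n f \<epsilon> (R t) (R (Suc t)))) \<and>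
     (\<forall>T. (top_down_step n f \<epsilon>)\<^sup>*\<^sup>* (Leaf ()) T \<longrightarrow>
          is_approximation n \<epsilon> f (completion n f T) \<or> (\<exists>T'. top_down_step n f \<epsilon> T T'))"

text \<open>The set of sizes the output can have, over all ways of breaking ties.\<close>

definition top_down_dt_sizes :: "nat \<Rightarrow> ((nat \<Rightarrow> bool) \<Rightarrow> real) \<Rightarrow> real \<Rightarrow> nat set" where
  "top_down_dt_sizes n f \<epsilon> = dt_size ` {D. top_down_output n f \<epsilon> D}"

end

theory Submission
  imports Defs
begin

text \<open>The cost of a bare tree is the average over its leaves \<open>\<ell>\<close>, with weights \<open>2^(-|\<ell>|)\<close>, of the total
  influence of \<open>f\<^sub>\<ell>\<close>. Splitting a leaf lowers the cost by exactly the score of the split. Let \<open>V\<close>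
  be the same average of the variances of the \<open>f\<^sub>\<ell>\<close>; if the completion errs by more than \<open>\<epsilon>\<close>,
  then \<open>V > 2\<epsilon>\<close>. By the OSSS inequality the best score for a tree of size \<open>m\<close> is at least
  \<open>V / (m log s)\<close>. Conversely, with \<open>d = log (s/\<epsilon>)\<close>, the cost is at most \<open>dV + 4\<epsilon> \<le> 3dV\<close>: the total
  influence of a function of sensitivity at most \<open>d\<close> is at most \<open>d\<close> times its variance, and
  the mean of \<open>2\<close> to the power of the sensitivity of \<open>f\<close> is at most \<open>s\<close>. Hence
  every step decreases \<open>cost + 6d\<epsilon>\<close> by a fraction of at least \<open>1 / (6 d m log s)\<close>. This potential
  can shrink by a factor of at most \<open>1/\<epsilon>\<close> in total, and summing \<open>1/m\<close> over the steps
  bounds the logarithm of the final size by \<open>6 d log s \<cdot> ln (1/\<epsilon>)\<close>.\<close>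

section \<open>Averages over the cube\<close>

text \<open>A finite sum in place of \<open>measure_pmf.expectation\<close>, so that linearity and
  monotonicity need no integrability conditions.\<close>

definition avg :: "nat \<Rightarrow> ((nat \<Rightarrow> bool) \<Rightarrow> real) \<Rightarrow> real" where
  "avg n g = (\<Sum>x\<in>cube n. g x) / 2 ^ n"

definition fix_coord :: "nat \<Rightarrow> bool \<Rightarrow> ((nat \<Rightarrow> bool) \<Rightarrow> 'a) \<Rightarrow> (nat \<Rightarrow> bool) \<Rightarrow> 'a" where
  "fix_coord i b g = (\<lambda>x. g (x(i := b)))"

definition pivotal :: "nat \<Rightarrow> ((nat \<Rightarrow> bool) \<Rightarrow> real) \<Rightarrow> (nat \<Rightarrow> bool) \<Rightarrow> real" where
  "pivotal i g x = of_bool (g x \<noteq> g (flip i x))"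

definition sens :: "nat \<Rightarrow> ((nat \<Rightarrow> bool) \<Rightarrow> real) \<Rightarrow> (nat \<Rightarrow> bool) \<Rightarrow> nat" where
  "sens n g x = card {i. i < n \<and> g x \<noteq> g (flip i x)}"

definition total_influence :: "nat \<Rightarrow> ((nat \<Rightarrow> bool) \<Rightarrow> real) \<Rightarrow> real" where
  "total_influence n g = (\<Sum>i<n. influence n i g)"

lemma finite_cube [simp]: "finite (cube n)"
  by (simp add: cube_def finite_PiE)

lemma card_cube: "card (cube n) = 2 ^ n"
  by (simp add: cube_def card_PiE)

lemma cube_nonempty: "cube n \<noteq> {}"
  by (simp add: cube_def PiE_eq_empty_iff)

lemma upd_in_cube [simp]: "x \<in> cube n \<Longrightarrow> i < n \<Longrightarrow> x(i := b) \<in> cube n"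
  by (auto simp: cube_def PiE_iff extensional_def)

lemma flip_in_cube [simp]: "x \<in> cube n \<Longrightarrow> i < n \<Longrightarrow> flip i x \<in> cube n"
  by (simp add: flip_def)

lemma flip_flip [simp]: "flip i (flip i x) = x"
  by (simp add: flip_def)

lemma expectation_uniform_cube: "measure_pmf.expectation (uniform_cube n) g = avg n g"
  by (simp add: integral_pmf_of_set cube_nonempty card_cube avg_def)

lemma prob_uniform_cube:
  "measure_pmf.prob (uniform_cube n) {x. P x} = avg n (\<lambda>x. of_bool (P x))"
proof -
  have "(\<Sum>x\<in>cube n. of_bool (P x) :: real) = real (card (cube n \<inter> {x. P x}))"
    by (simp add: sum.If_cases of_bool_def)
  then show ?thesis
    by (simp add: measure_pmf_of_set cube_nonempty card_cube avg_def)
qed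

lemma influence_eq_avg: "influence n i g = avg n (pivotal i g)"
  by (simp add: influence_def prob_uniform_cube pivotal_def[abs_def])

lemma avg_cong: "(\<And>x. x \<in> cube n \<Longrightarrow> g x = h x) \<Longrightarrow> avg n g = avg n h"
  by (simp add: avg_def)

lemma avg_mono: "(\<And>x. x \<in> cube n \<Longrightarrow> g x \<le> h x) \<Longrightarrow> avg n g \<le> avg n h"
  by (simp add: avg_def divide_right_mono sum_mono)

lemma avg_add: "avg n (\<lambda>x. g x + h x) = avg n g + avg n h"
  by (simp add: avg_def sum.distrib add_divide_distrib)

lemma avg_diff: "avg n (\<lambda>x. g x - h x) = avg n g - avg n h"
  by (simp add: avg_def sum_subtractf diff_divide_distrib)

lemma avg_mult: "avg n (\<lambda>x. c * g x) = c * avg n g"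
  by (simp add: avg_def sum_distrib_left)

lemma avg_const [simp]: "avg n (\<lambda>x. c) = c"
  by (simp add: avg_def card_cube)

lemma avg_sum: "avg n (\<lambda>x. \<Sum>i\<in>A. g i x) = (\<Sum>i\<in>A. avg n (g i))"
  unfolding avg_def by (subst sum.swap) (simp add: sum_divide_distrib)

lemma abs_avg_le: "\<bar>avg n g\<bar> \<le> avg n (\<lambda>x. \<bar>g x\<bar>)"
  by (simp add: avg_def divide_right_mono)

lemma avg_flip:
  assumes "i < n"
  shows "avg n (\<lambda>x. g (flip i x)) = avg n g"
proof -
  have "bij_betw (flip i) (cube n) (cube n)"
    by (rule bij_betw_byWitness[where f' = "flip i"]) (use assms in auto)
  then show ?thesis
    unfolding avg_def by (subst sum.reindex_bij_betw[symmetric]) auto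
qed

text \<open>The two fixings of \<open>i\<close> send \<open>x\<close> to \<open>x\<close> and
  \<open>flip i x\<close> in some order, and \<open>flip i\<close> preserves the uniform
  measure.\<close>

lemma avg_split:
  assumes "i < n"
  shows "avg n g = (avg n (fix_coord i False g) + avg n (fix_coord i True g)) / 2"
proof -
  have eq: "g x + g (flip i x) = fix_coord i False g x + fix_coord i True g x" for x
    by (cases "x i") (simp_all add: fix_coord_def flip_def fun_upd_idem)
  have "2 * avg n g = avg n (\<lambda>x. g x + g (flip i x))"
    by (simp add: avg_add avg_flip[OF assms])
  then show ?thesis
    by (simp add: eq avg_add)
qed

section \<open>Influence and sensitivity\<close>

lemma sens_eq_sum: "real (sens n g x) = (\<Sum>i<n. pivotal i g x)"
proof -
  have "(\<Sum>i<n. pivotal i g x) = real (card ({..<n} \<inter> {i. g x \<noteq> g (flip i x)}))"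
    by (simp add: pivotal_def sum.If_cases of_bool_def)
  also have "{..<n} \<inter> {i. g x \<noteq> g (flip i x)} = {i. i < n \<and> g x \<noteq> g (flip i x)}"
    by auto
  finally show ?thesis by (simp add: sens_def)
qed

lemma influence_nonneg: "0 \<le> influence n i g"
  by (simp add: influence_def)

lemma total_influence_nonneg: "0 \<le> total_influence n g"
  by (simp add: total_influence_def influence_nonneg sum_nonneg)

lemma fix_coord_pm:
  "g \<in> cube n \<rightarrow> {-1, 1} \<Longrightarrow> i < n \<Longrightarrow> fix_coord i b g \<in> cube n \<rightarrow> {-1, 1}"
  unfolding fix_coord_def by (intro funcsetI) (blast dest: funcset_mem upd_in_cube)

lemma flip_upd:
  "(flip k x)(i := b) = (if k = i then x(i := b) else flip k (x(i := b)))"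
  by (auto simp: flip_def fun_eq_iff)

lemma fix_coord_flip_neq_iff:
  "fix_coord i b g x \<noteq> fix_coord i b g (flip k x) \<longleftrightarrow>
    k \<noteq> i \<and> g (x(i := b)) \<noteq> g (flip k (x(i := b)))"
  by (simp add: fix_coord_def flip_upd)

lemma pivotal_fix_coord:
  "pivotal k (fix_coord i b g) x = (if k = i then 0 else pivotal k g (x(i := b)))"
  unfolding pivotal_def fix_coord_flip_neq_iff by simp

lemma avg_influence_fix_coord:
  assumes "i < n"
  shows "(influence n k (fix_coord i False g) + influence n k (fix_coord i True g)) / 2 =
    (if k = i then 0 else influence n k g)"
proof (cases "k = i")
  case True
  then have "pivotal k (fix_coord i b g) = (\<lambda>x. 0)" for b
    by (simp add: pivotal_fix_coord fun_eq_iff)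
  then show ?thesis using True by (simp add: influence_eq_avg)
next
  case False
  then have "pivotal k (fix_coord i b g) = fix_coord i b (pivotal k g)" for b
    by (simp add: pivotal_fix_coord fun_eq_iff fix_coord_def[of i b "pivotal k g"])
  then show ?thesis
    using False avg_split[OF assms, of "pivotal k g"] by (simp add: influence_eq_avg)
qed

text \<open>Fixing \<open>i\<close> commutes with \<open>pivotal k\<close> for
  \<open>k \<noteq> i\<close> and makes \<open>i\<close> irrelevant, so exactly the term of
  \<open>i\<close> is lost. This is the drop of the cost at a split leaf.\<close>

lemma avg_total_influence_fix_coord:
  assumes "i < n"
  shows "(total_influence n (fix_coord i False g) + total_influence n (fix_coord i True g)) / 2 =
    total_influence n g - influence n i g"
proof -
  have "(total_influence n (fix_coord i False g) + total_influence n (fix_coord i True g)) / 2 =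
      (\<Sum>k<n. if k = i then 0 else influence n k g)"
    by (simp add: total_influence_def sum.distrib[symmetric] sum_divide_distrib
        avg_influence_fix_coord[OF assms])
  also have "\<dots> = (\<Sum>k<n. influence n k g - (if k = i then influence n i g else 0))"
    by (intro sum.cong) auto
  also have "\<dots> = total_influence n g - influence n i g"
    using assms by (simp add: sum_subtractf total_influence_def)
  finally show ?thesis .
qed

section \<open>Total influence, variance and sensitivity\<close>

lemma influence_le_avg_pivotal_square:
  assumes g: "g \<in> cube n \<rightarrow> {-1, 1}" and i: "i < n"
  shows "influence n i g \<le> avg n (\<lambda>x. pivotal i g x * (g x - c)\<^sup>2)"
proof -
  let ?w = "\<lambda>x. pivotal i g x * (g x - c)\<^sup>2"
  \<comment> \<open>Where \<open>i\<close> is pivotal, \<open>g x\<close> and \<open>g (flip i x)\<close> are \<open>1\<close> and \<open>-1\<close> in some order.\<close>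
  have "2 * pivotal i g x \<le> ?w x + ?w (flip i x)" if x: "x \<in> cube n" for x
  proof -
    have "g x \<in> {-1, 1}" "g (flip i x) \<in> {-1, 1}"
      using g x i by (auto dest: funcset_mem)
    moreover have "2 \<le> (1 - c)\<^sup>2 + (- 1 - c)\<^sup>2"
      by (simp add: power2_eq_square algebra_simps)
    ultimately show ?thesis
      by (auto simp: pivotal_def)
  qed
  then have "avg n (\<lambda>x. 2 * pivotal i g x) \<le> avg n (\<lambda>x. ?w x + ?w (flip i x))"
    by (rule avg_mono)
  then show ?thesis
    by (simp add: avg_mult avg_add avg_flip[OF i, of ?w] influence_eq_avg)
qed

text \<open>Each pivotal coordinate contributes one copy of the squared deviation. If the
  sensitivity is at most \<open>d\<close> and \<open>c\<close> is the mean, this gives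
  \<open>d\<close> times the variance.\<close>

lemma total_influence_le_avg_sens_square:
  assumes "g \<in> cube n \<rightarrow> {-1, 1}"
  shows "total_influence n g \<le> avg n (\<lambda>x. real (sens n g x) * (g x - c)\<^sup>2)"
proof -
  have "total_influence n g \<le> (\<Sum>i<n. avg n (\<lambda>x. pivotal i g x * (g x - c)\<^sup>2))"
    unfolding total_influence_def
    by (intro sum_mono influence_le_avg_pivotal_square[OF assms]) auto
  then show ?thesis
    by (simp add: avg_sum[symmetric] sum_distrib_right[symmetric] sens_eq_sum)
qed

text \<open>Since \<open>g\<close> squares to 1 on the cube, the variance has the form
  \<open>1 - (avg n g)\<^sup>2\<close>, which is used from here on.\<close>

lemma avg_square_deviation:
  assumes g: "g \<in> cube n \<rightarrow> {-1, 1}"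
  shows "avg n (\<lambda>x. (g x - avg n g)\<^sup>2) = 1 - (avg n g)\<^sup>2"
proof -
  define c where "c = avg n g"
  have "avg n (\<lambda>x. (g x - c)\<^sup>2) = avg n (\<lambda>x. (1 + c\<^sup>2) - (2 * c) * g x)"
  proof (rule avg_cong)
    fix x assume "x \<in> cube n"
    then have "g x \<in> {-1, 1}" using g by auto
    then show "(g x - c)\<^sup>2 = (1 + c\<^sup>2) - (2 * c) * g x"
      by (auto simp: power2_eq_square algebra_simps)
  qed
  also have "\<dots> = 1 + c\<^sup>2 - 2 * c * c"
    by (simp add: avg_diff avg_mult c_def)
  finally show ?thesis by (simp add: c_def power2_eq_square)
qed

lemma abs_pm: "g \<in> cube n \<rightarrow> {-1, 1} \<Longrightarrow> x \<in> cube n \<Longrightarrow> \<bar>g x\<bar> = (1 :: real)"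
  by (drule (1) funcset_mem) auto

lemma abs_avg_pm_le_1:
  assumes g: "g \<in> cube n \<rightarrow> {-1, 1}"
  shows "\<bar>avg n g\<bar> \<le> 1"
proof -
  have "avg n (\<lambda>x. \<bar>g x\<bar>) \<le> avg n (\<lambda>x. 1)"
    by (rule avg_mono) (simp add: abs_pm[OF g])
  then show ?thesis using abs_avg_le[of n g] by simp
qed

text \<open>From \<open>z \<le> exp (z - 1)\<close> at \<open>z = y * ln 2\<close>, together with
  \<open>1 \<le> exp 1 * ln 2\<close>.\<close>

lemma le_two_powr: "y \<le> 2 powr (y :: real)"
proof (cases "y \<le> 0")
  case True
  then show ?thesis by (meson order_trans powr_ge_zero)
next
  case False
  have "1 \<le> 2 * ln (2 :: real)"
    using ln2_ge_two_thirds by simp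
  also have "\<dots> \<le> exp 1 * ln 2"
    using exp_ge_add_one_self[of 1] by (intro mult_right_mono) simp_all
  finally have "y \<le> exp 1 * (y * ln 2)"
    using False mult_left_mono[of 1 "exp 1 * ln 2" y] by (simp add: mult_ac)
  also have "\<dots> \<le> exp 1 * exp (y * ln 2 - 1)"
    using exp_ge_add_one_self[of "y * ln 2 - 1"] by (intro mult_left_mono) simp_all
  also have "\<dots> = 2 powr y"
    by (simp add: powr_def exp_add[symmetric])
  finally show ?thesis .
qed

text \<open>The sensitivity is split at a free threshold \<open>d\<close>: \<open>d\<close> itself
  yields the variance term, and the excess is at most 2 to the power of the excess.\<close>

lemma total_influence_le_variance_add:
  assumes g: "g \<in> cube n \<rightarrow> {-1, 1}"
  shows "total_influence n g \<le>
    d * (1 - (avg n g)\<^sup>2) + 4 * 2 powr (- d) * avg n (\<lambda>x. 2 ^ sens n g x)"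
proof -
  define c where "c = avg n g"
  have "real (sens n g x) * (g x - c)\<^sup>2 \<le>
      d * (g x - c)\<^sup>2 + 4 * 2 powr (- d) * 2 ^ sens n g x" if x: "x \<in> cube n" for x
  proof -
    have "real (sens n g x) - d \<le> 2 powr (- d) * 2 ^ sens n g x"
      using le_two_powr[of "real (sens n g x) - d"]
      by (simp add: powr_diff powr_minus powr_realpow divide_simps mult.commute)
    moreover have "(g x - c)\<^sup>2 \<le> 4"
    proof -
      have "\<bar>g x - c\<bar> \<le> 2"
        using abs_avg_pm_le_1[OF g] abs_pm[OF g x] unfolding c_def by linarith
      then have "(g x - c)\<^sup>2 \<le> 2\<^sup>2" by (rule power2_le_iff_abs_le[THEN iffD2, rotated]) simp
      then show ?thesis by simp
    qed
    \<comment> \<open>The excess may be negative, so it is replaced by its nonnegative bound before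
      the square is replaced by 4.\<close>
    ultimately have "(real (sens n g x) - d) * (g x - c)\<^sup>2 \<le> (2 powr (- d) * 2 ^ sens n g x) * 4"
      by (intro order_trans[OF mult_right_mono mult_left_mono]) auto
    then show ?thesis by (simp add: algebra_simps)
  qed
  then have "avg n (\<lambda>x. real (sens n g x) * (g x - c)\<^sup>2) \<le>
      avg n (\<lambda>x. d * (g x - c)\<^sup>2 + 4 * 2 powr (- d) * 2 ^ sens n g x)"
    by (rule avg_mono)
  also have "\<dots> = d * avg n (\<lambda>x. (g x - c)\<^sup>2) +
      4 * 2 powr (- d) * avg n (\<lambda>x. 2 ^ sens n g x)"
    by (simp add: avg_add avg_mult)
  finally show ?thesis
    using total_influence_le_avg_sens_square[OF g, of c] avg_square_deviation[OF g]
    by (simp add: c_def)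
qed

section \<open>Exponential moment of the sensitivity\<close>

lemma sens_fix_coord_le: "sens n (fix_coord i b g) x \<le> sens n g (x(i := b))"
  unfolding sens_def fix_coord_flip_neq_iff by (rule card_mono) auto

lemma sens_le_Suc_sens_fix_coord: "sens n g (x(i := b)) \<le> Suc (sens n (fix_coord i b g) x)"
proof -
  have "{k. k < n \<and> g (x(i := b)) \<noteq> g (flip k (x(i := b)))} \<subseteq>
      insert i {k. k < n \<and> fix_coord i b g x \<noteq> fix_coord i b g (flip k x)}"
    unfolding fix_coord_flip_neq_iff by auto
  then have "sens n g (x(i := b)) \<le>
      card (insert i {k. k < n \<and> fix_coord i b g x \<noteq> fix_coord i b g (flip k x)})"
    unfolding sens_def by (rule card_mono[rotated]) simp
  also have "\<dots> \<le> Suc (sens n (fix_coord i b g) x)"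
    unfolding sens_def by (rule card_insert_le_m1) simp_all
  finally show ?thesis .
qed

text \<open>Sensitivity never grows under a restriction. This carries a bound at the root to the
  average over the leaves of any bare tree.\<close>

lemma avg_exp_sens_fix_coord_le:
  assumes "i < n"
  shows "(avg n (\<lambda>x. 2 ^ sens n (fix_coord i False g) x) +
      avg n (\<lambda>x. 2 ^ sens n (fix_coord i True g) x)) / 2 \<le> avg n (\<lambda>x. 2 ^ sens n g x)"
proof -
  have "avg n (\<lambda>x. 2 ^ sens n (fix_coord i b g) x) \<le> avg n (fix_coord i b (\<lambda>x. 2 ^ sens n g x))" for b
    unfolding fix_coord_def[of i b "\<lambda>x. 2 ^ sens n g x"]
    by (intro avg_mono power_increasing sens_fix_coord_le) simp
  from this[of False] this[of True] show ?thesis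
    by (subst avg_split[OF assms, of "\<lambda>x. 2 ^ sens n g x"]) simp
qed

text \<open>Only \<open>i\<close> itself can stop being sensitive, which costs a factor 2; this
  cancels the 1/2 of \<open>avg_split\<close>.\<close>

lemma avg_exp_sens_le:
  assumes "i < n"
  shows "avg n (\<lambda>x. 2 ^ sens n g x) \<le>
    avg n (\<lambda>x. 2 ^ sens n (fix_coord i False g) x) + avg n (\<lambda>x. 2 ^ sens n (fix_coord i True g) x)"
proof -
  have "avg n (fix_coord i b (\<lambda>x. 2 ^ sens n g x)) \<le> 2 * avg n (\<lambda>x. 2 ^ sens n (fix_coord i b g) x)" for b
    unfolding fix_coord_def[of i b "\<lambda>x. 2 ^ sens n g x"] avg_mult[symmetric] power_Suc[symmetric]
    by (intro avg_mono power_increasing sens_le_Suc_sens_fix_coord) simp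
  from this[of False] this[of True] show ?thesis
    by (subst avg_split[OF assms, of "\<lambda>x. 2 ^ sens n g x"]) simp
qed

section \<open>Decision tree complexity and the OSSS inequality\<close>

text \<open>A tree for \<open>g\<close> is unrolled into the restrictions of \<open>g\<close> themselves, so that variables that
  are queried repeatedly on a path need no special treatment.\<close>

inductive dt_complexity_le :: "nat \<Rightarrow> nat \<Rightarrow> ((nat \<Rightarrow> bool) \<Rightarrow> real) \<Rightarrow> bool" for n where
  const: "(\<And>x. x \<in> cube n \<Longrightarrow> g x = a) \<Longrightarrow> 0 < s \<Longrightarrow> dt_complexity_le n s g"
| split: "i < n \<Longrightarrow> dt_complexity_le n s (fix_coord i False g) \<Longrightarrow>
    dt_complexity_le n t (fix_coord i True g) \<Longrightarrow> dt_complexity_le n (s + t) g"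

lemma dt_complexity_le_pos: "dt_complexity_le n s g \<Longrightarrow> 0 < s"
  by (induction rule: dt_complexity_le.induct) auto

lemma dt_complexity_le_cong:
  "dt_complexity_le n s g \<Longrightarrow> (\<And>x. x \<in> cube n \<Longrightarrow> g x = h x) \<Longrightarrow> dt_complexity_le n s h"
proof (induction s g arbitrary: h rule: dt_complexity_le.induct)
  case (const g a s)
  then show ?case by (intro dt_complexity_le.const[of _ _ a]) auto
next
  case (split i s g t)
  then show ?case
    by (intro dt_complexity_le.split[of i]) (auto simp: fix_coord_def)
qed

lemma dt_complexity_le_mono: "dt_complexity_le n s g \<Longrightarrow> s \<le> t \<Longrightarrow> dt_complexity_le n t g"
proof (induction s g arbitrary: t rule: dt_complexity_le.induct)
  case (const g a s)
  then show ?case by (intro dt_complexity_le.const[of _ _ a]) auto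
next
  case (split i s g t u)
  \<comment> \<open>All the slack goes to the second subtree, as
    \<open>t \<le> u - s\<close>.\<close>
  then have "dt_complexity_le n (s + (u - s)) g"
    by (intro dt_complexity_le.split[of i]) auto
  then show ?case using split.prems by simp
qed

lemma fix_coord_twist:
  "i \<noteq> j \<Longrightarrow> fix_coord i b (fix_coord j c g) = fix_coord j c (fix_coord i b g)"
  by (simp add: fix_coord_def fun_upd_twist[of i j])

text \<open>In a tree for \<open>g\<close>, a query of \<open>j\<close> is replaced by the subtree
  that \<open>b\<close> selects; all other queries stay.\<close>

lemma dt_complexity_le_fix_coord:
  "dt_complexity_le n s g \<Longrightarrow> j < n \<Longrightarrow> dt_complexity_le n s (fix_coord j b g)"
proof (induction s g rule: dt_complexity_le.induct)
  case (const g a s)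
  then show ?case by (intro dt_complexity_le.const[of _ _ a]) (auto simp: fix_coord_def)
next
  case (split i s g t)
  show ?case
  proof (cases "i = j")
    case True
    then show ?thesis using split.hyps
      by (cases b) (auto intro: dt_complexity_le_mono)
  next
    case False
    then show ?thesis using split
      by (intro dt_complexity_le.split[of i]) (auto simp: fix_coord_twist)
  qed
qed

text \<open>The induction hypotheses concern the unrestricted functions of the subtrees; fixing the
  root variable in them does not raise their complexity and gives the restrictions of the whole
  tree.\<close>

lemma dt_complexity_le_dt_eval:
  "dt_vars T \<subseteq> {..<n} \<Longrightarrow> dt_complexity_le n (dt_size T) (dt_eval T)"
proof (induction T)
  case (Leaf a)
  then show ?case by (auto intro: dt_complexity_le.const)
next
  case (Query i l r)
  then have "dt_complexity_le n (dt_size l) (fix_coord i False (dt_eval l))"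
    "dt_complexity_le n (dt_size r) (fix_coord i True (dt_eval r))"
    by (auto intro: dt_complexity_le_fix_coord)
  moreover have "fix_coord i False (dt_eval (Query i l r)) = fix_coord i False (dt_eval l)"
    "fix_coord i True (dt_eval (Query i l r)) = fix_coord i True (dt_eval r)"
    by (auto simp: fix_coord_def)
  ultimately show ?case
    using Query.prems dt_complexity_le.split[of i n "dt_size l" "dt_eval (Query i l r)" "dt_size r"]
    by (simp del: dt_eval.simps)
qed

lemma computable_imp_dt_complexity_le:
  "computable_by_dt_of_size n f s \<Longrightarrow> dt_complexity_le n s f"
  unfolding computable_by_dt_of_size_def
  using dt_complexity_le_cong dt_complexity_le_dt_eval by blast

text \<open>The intuition, for a tree without repeated queries: the sensitivity at \<open>x\<close>
  is at most the depth of the leaf reached, and a leaf of depth \<open>k\<close> is reached with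
  probability \<open>1 / 2 ^ k\<close>, so each leaf contributes at most 1.\<close>

lemma avg_exp_sens_le_dt_complexity:
  "dt_complexity_le n s g \<Longrightarrow> avg n (\<lambda>x. 2 ^ sens n g x) \<le> real s"
proof (induction s g rule: dt_complexity_le.induct)
  case (const g a s)
  have "avg n (\<lambda>x. 2 ^ sens n g x) = avg n (\<lambda>x. 1)"
  proof (rule avg_cong)
    fix x assume "x \<in> cube n"
    then have "{i. i < n \<and> g x \<noteq> g (flip i x)} = {}"
      using const by auto
    then show "2 ^ sens n g x = (1 :: real)"
      by (simp add: sens_def del: Collect_empty_eq)
  qed
  then show ?case using const by simp
next
  case (split i s g t)
  then show ?case using avg_exp_sens_le[of i n g] by simp
qed

section \<open>Covariance against influence\<close>

text \<open>The inequality of arithmetic and geometric means, in the form that bounds expected depth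
  by the logarithm of the size; the 1 counts the root query.\<close>

lemma log2_add_ge:
  assumes "0 < a" "0 < (b :: real)"
  shows "1 + (log 2 a + log 2 b) / 2 \<le> log 2 (a + b)"
proof -
  have "4 * (a * b) \<le> (a + b)\<^sup>2"
    using zero_le_power2[of "a - b"] by (simp add: power2_eq_square algebra_simps)
  then have "log 2 (4 * (a * b)) \<le> log 2 ((a + b)\<^sup>2)"
    using assms by (subst log_le_cancel_iff) auto
  moreover have "log 2 4 = (2 :: real)"
    using log_nat_power[of 2 2 2] by simp
  ultimately show ?thesis
    using assms by (simp add: log_mult log_nat_power field_simps)
qed

text \<open>Of \<open>x\<close> and \<open>flip i x\<close>, exactly one is moved by setting
  \<open>i\<close> to \<open>b\<close>, and a pivotal \<open>i\<close> then changes the value by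
  2.\<close>

lemma avg_abs_diff_fix_coord:
  assumes g: "g \<in> cube n \<rightarrow> {-1, 1}" and i: "i < n"
  shows "avg n (\<lambda>x. \<bar>fix_coord i b g x - g x\<bar>) = influence n i g"
proof -
  let ?w = "\<lambda>x. \<bar>fix_coord i b g x - g x\<bar>"
  have "?w x + ?w (flip i x) = 2 * pivotal i g x" if x: "x \<in> cube n" for x
  proof -
    have pm: "g x \<in> {-1, 1}" "g (flip i x) \<in> {-1, 1}"
      using g x i by (auto dest: funcset_mem)
    have "(flip i x)(i := b) = x(i := b)" by (simp add: flip_def)
    moreover have "x(i := b) = (if x i = b then x else flip i x)"
      by (auto simp: flip_def fun_eq_iff)
    ultimately show ?thesis using pm by (auto simp: pivotal_def fix_coord_def)
  qed
  then have "avg n (\<lambda>x. ?w x + ?w (flip i x)) = avg n (\<lambda>x. 2 * pivotal i g x)"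
    by (rule avg_cong)
  then show ?thesis
    by (simp add: avg_mult avg_add avg_flip[OF i, of ?w] influence_eq_avg)
qed

text \<open>A form of the inequality of O'Donnell, Saks, Schramm and Servedio. Conditioning on the root
  variable of a tree for \<open>g\<close>, but resampling it in \<open>h\<close>, costs one influence of \<open>h\<close>;
  \<open>h\<close> itself is never restricted, so that the number of such steps is the expected depth
  of the tree.\<close>

lemma abs_covariance_le:
  assumes "dt_complexity_le n s g" and "g \<in> cube n \<rightarrow> {-1, 1}"
    and h: "h \<in> cube n \<rightarrow> {-1, 1}"
    and M: "\<And>i. i < n \<Longrightarrow> influence n i h \<le> M" "0 \<le> M"
  shows "\<bar>avg n (\<lambda>x. g x * h x) - avg n g * avg n h\<bar> \<le> M * log 2 (real s)"
  using assms(1,2)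
proof (induction s g rule: dt_complexity_le.induct)
  case (const g a s)
  have "avg n g = avg n (\<lambda>x. a)" "avg n (\<lambda>x. g x * h x) = avg n (\<lambda>x. a * h x)"
    by (rule avg_cong, simp add: const.hyps(1))+
  moreover have "0 \<le> M * log 2 (real s)"
    using const.hyps(2) M by simp
  ultimately show ?case by (simp add: avg_mult)
next
  case (split i s g t)
  have *: "\<bar>avg n (fix_coord i b (\<lambda>x. g x * h x)) - avg n (fix_coord i b g) * avg n h\<bar> \<le>
      M + M * log 2 (real u)"
    if IH: "\<bar>avg n (\<lambda>x. fix_coord i b g x * h x) - avg n (fix_coord i b g) * avg n h\<bar> \<le>
      M * log 2 (real u)" for b u
  proof -
    let ?g = "fix_coord i b g"
    have pm: "?g \<in> cube n \<rightarrow> {-1, 1}"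
      using split by (intro fix_coord_pm)
    \<comment> \<open>Replacing the restricted \<open>h\<close> by \<open>h\<close> itself costs one
      influence, because the other factor has absolute value 1.\<close>
    have "avg n (fix_coord i b (\<lambda>x. g x * h x)) - avg n (\<lambda>x. ?g x * h x) =
        avg n (\<lambda>x. ?g x * (fix_coord i b h x - h x))"
      by (simp add: avg_diff[symmetric] fix_coord_def algebra_simps)
    moreover have "\<bar>\<dots>\<bar> \<le> avg n (\<lambda>x. \<bar>?g x * (fix_coord i b h x - h x)\<bar>)"
      by (rule abs_avg_le)
    moreover have "\<dots> = avg n (\<lambda>x. \<bar>fix_coord i b h x - h x\<bar>)"
      by (rule avg_cong) (simp add: abs_mult abs_pm[OF pm])
    moreover have "\<dots> \<le> M"
      using M(1)[OF split(1)] avg_abs_diff_fix_coord[OF h split(1)] by simp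
    ultimately show ?thesis using IH by linarith
  qed
  have "1 + (log 2 (real s) + log 2 (real t)) / 2 \<le> log 2 (real (s + t))"
    using split.hyps dt_complexity_le_pos log2_add_ge[of "real s" "real t"] by auto
  then have "M * (1 + (log 2 (real s) + log 2 (real t)) / 2) \<le> M * log 2 (real (s + t))"
    using M by (intro mult_left_mono)
  then have "M + (M * log 2 (real s) + M * log 2 (real t)) / 2 \<le> M * log 2 (real (s + t))"
    by (simp add: algebra_simps)
  moreover have "avg n (\<lambda>x. g x * h x) - avg n g * avg n h =
    ((avg n (fix_coord i False (\<lambda>x. g x * h x)) - avg n (fix_coord i False g) * avg n h) +
     (avg n (fix_coord i True (\<lambda>x. g x * h x)) - avg n (fix_coord i True g) * avg n h)) / 2"
    using avg_split[OF split(1), of "\<lambda>x. g x * h x"] avg_split[OF split(1), of g]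
    by (simp add: algebra_simps add_divide_distrib)
  moreover have "\<bar>c\<bar> \<le> K"
    if "M + (a + b) / 2 \<le> K" "c = (p + q) / 2" "\<bar>p\<bar> \<le> M + a" "\<bar>q\<bar> \<le> M + b"
    for a b c p q K :: real
    using that(1,2) abs_le_D1[OF that(3)] abs_le_D2[OF that(3)]
      abs_le_D1[OF that(4)] abs_le_D2[OF that(4)]
    by (intro abs_leI) (simp_all add: field_simps)
  ultimately show ?case
    using *[OF split.IH(1)[OF fix_coord_pm[OF split.prems split(1)]]]
      *[OF split.IH(2)[OF fix_coord_pm[OF split.prems split(1)]]]
    by blast
qed

text \<open>The covariance of \<open>g\<close> with itself.\<close>

lemma variance_le_max_influence:
  assumes "dt_complexity_le n s g" and g: "g \<in> cube n \<rightarrow> {-1, 1}"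
    and "\<And>i. i < n \<Longrightarrow> influence n i g \<le> M" "0 \<le> M"
  shows "1 - (avg n g)\<^sup>2 \<le> M * log 2 (real s)"
proof -
  have "avg n (\<lambda>x. g x * g x) = avg n (\<lambda>x. 1)"
    by (rule avg_cong) (metis abs_pm[OF g] abs_mult_self_eq mult_1)
  then show ?thesis
    using abs_covariance_le[OF assms(1) g g assms(3,4)] by (simp add: power2_eq_square)
qed

section \<open>Averages over the leaves of a bare tree\<close>

text \<open>The weights \<open>1 / 2 ^ length p\<close> arise from halving at each query.
  Restricting \<open>f\<close> on the way down avoids paths, at the price of inductions that
  generalise over \<open>f\<close>.\<close>

primrec leaf_avg ::
  "(((nat \<Rightarrow> bool) \<Rightarrow> real) \<Rightarrow> real) \<Rightarrow> 'a dtree \<Rightarrow> ((nat \<Rightarrow> bool) \<Rightarrow> real) \<Rightarrow> real" where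
  "leaf_avg F (Leaf a) f = F f"
| "leaf_avg F (Query i l r) f =
     (leaf_avg F l (fix_coord i False f) + leaf_avg F r (fix_coord i True f)) / 2"

text \<open>Ensures that fixing the root variable leaves the evaluation of both subtrees unchanged,
  as the recursion for the error of the completion requires.\<close>

primrec read_once :: "'a dtree \<Rightarrow> bool" where
  "read_once (Leaf a) \<longleftrightarrow> True"
| "read_once (Query i l r) \<longleftrightarrow>
     i \<notin> dt_vars l \<and> i \<notin> dt_vars r \<and> read_once l \<and> read_once r"

lemma dt_size_pos: "0 < dt_size T"
  by (induction T) auto

lemma finite_leaves: "finite (leaves T)"
  by (induction T) auto

lemma leaves_nonempty: "leaves T \<noteq> {}"
  by (induction T) auto

lemma leaves_vars: "p \<in> leaves T \<Longrightarrow> fst ` set p \<subseteq> dt_vars T"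
  by (induction T arbitrary: p) fastforce+

lemma restrict_path_Cons:
  "restrict_path f ((i, b) # p) = restrict_path (fix_coord i b f) p"
  by (simp add: fix_coord_def)

lemma restrict_path_pm:
  "f \<in> cube n \<rightarrow> {-1, 1} \<Longrightarrow> fst ` set p \<subseteq> {..<n} \<Longrightarrow> restrict_path f p \<in> cube n \<rightarrow> {-1, 1}"
proof (induction p arbitrary: f)
  case (Cons q p)
  then show ?case
    by (cases q) (auto simp only: restrict_path_Cons list.set image_insert insert_subset
        fst_conv lessThan_iff fix_coord_pm)
qed simp

lemma dt_complexity_le_restrict_path:
  "dt_complexity_le n s f \<Longrightarrow> fst ` set p \<subseteq> {..<n} \<Longrightarrow> dt_complexity_le n s (restrict_path f p)"
proof (induction p arbitrary: f)
  case (Cons q p)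
  then show ?case
    by (cases q) (auto simp only: restrict_path_Cons list.set image_insert insert_subset
        fst_conv lessThan_iff dt_complexity_le_fix_coord)
qed simp

lemma restrict_path_upd_irrelevant:
  "(\<And>x b. f (x(i := b)) = f x) \<Longrightarrow> restrict_path f p (x(i := b)) = restrict_path f p x"
proof (induction p arbitrary: f)
  case (Cons q p)
  have "f ((y(i := c))(fst q := snd q)) = f (y(fst q := snd q))" for y c
    by (metis Cons.prems fun_upd_twist fun_upd_upd)
  then show ?case
    unfolding restrict_path.simps by (rule Cons.IH)
qed simp

lemma restrict_path_upd:
  "i \<in> fst ` set p \<Longrightarrow> restrict_path f p (x(i := b)) = restrict_path f p x"
proof (induction p arbitrary: f)
  case (Cons q p)
  show ?case
  proof (cases "i \<in> fst ` set p")
    case True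
    then show ?thesis
      unfolding restrict_path.simps by (rule Cons.IH)
  next
    case False
    then have "i = fst q" using Cons.prems by simp
    then show ?thesis
      unfolding restrict_path.simps by (intro restrict_path_upd_irrelevant) simp
  qed
qed simp

text \<open>Used to show that a choice of positive score is always a new variable.\<close>

lemma influence_restrict_path_queried:
  "i \<in> fst ` set p \<Longrightarrow> influence n i (restrict_path f p) = 0"
  by (simp add: influence_def flip_def restrict_path_upd)

text \<open>The comparison is demanded only at the leaves, because the bounds to be averaged concern
  functions with values -1 and 1.\<close>

lemma leaf_avg_mono:
  "(\<And>p. p \<in> leaves T \<Longrightarrow> F (restrict_path f p) \<le> G (restrict_path f p)) \<Longrightarrow>
    leaf_avg F T f \<le> leaf_avg G T f"
proof (induction T arbitrary: f)
  case (Query i l r)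
  have "leaf_avg F l (fix_coord i False f) \<le> leaf_avg G l (fix_coord i False f)"
    by (rule Query.IH(1)) (metis Query.prems UnI1 imageI leaves.simps(2) restrict_path_Cons)
  moreover have "leaf_avg F r (fix_coord i True f) \<le> leaf_avg G r (fix_coord i True f)"
    by (rule Query.IH(2)) (metis Query.prems UnI2 imageI leaves.simps(2) restrict_path_Cons)
  ultimately show ?case by simp
qed simp

text \<open>The weight of a leaf cancels the factor \<open>2 ^ length p\<close>, so each leaf
  contributes at most \<open>K\<close>.\<close>

lemma leaf_avg_le_size:
  "(\<And>p. p \<in> leaves T \<Longrightarrow> F (restrict_path f p) \<le> K * 2 ^ length p) \<Longrightarrow>
    leaf_avg F T f \<le> K * real (dt_size T)"
proof (induction T arbitrary: f K)
  case (Query i l r)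
  \<comment> \<open>Paths in a subtree are shorter by one, so the constant doubles; the halving at
    the root undoes this.\<close>
  have "F (restrict_path (fix_coord i False f) p) \<le> 2 * K * 2 ^ length p" if "p \<in> leaves l" for p
    using Query.prems[of "(i, False) # p"] that unfolding restrict_path_Cons by simp
  moreover have "F (restrict_path (fix_coord i True f) p) \<le> 2 * K * 2 ^ length p"
    if "p \<in> leaves r" for p
    using Query.prems[of "(i, True) # p"] that unfolding restrict_path_Cons by simp
  ultimately show ?case
    using Query.IH(1)[of "fix_coord i False f" "2 * K"] Query.IH(2)[of "fix_coord i True f" "2 * K"]
    by (simp add: algebra_simps)
qed simp

lemma leaf_avg_linear:
  "leaf_avg (\<lambda>g. a * F g + b * G g) T f = a * leaf_avg F T f + b * leaf_avg G T f"
  by (induction T arbitrary: f) (simp_all add: field_simps)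

lemma leaf_avg_nonneg: "(\<And>g. 0 \<le> F g) \<Longrightarrow> 0 \<le> leaf_avg F T f"
  by (induction T arbitrary: f) simp_all

text \<open>A supermartingale argument: no query raises the average of \<open>F\<close>.\<close>

lemma leaf_avg_superharmonic:
  assumes "\<And>i g. i < n \<Longrightarrow> (F (fix_coord i False g) + F (fix_coord i True g)) / 2 \<le> F g"
  shows "dt_vars T \<subseteq> {..<n} \<Longrightarrow> leaf_avg F T f \<le> F f"
proof (induction T arbitrary: f)
  case (Query i l r)
  then have "i < n" "dt_vars l \<subseteq> {..<n}" "dt_vars r \<subseteq> {..<n}" by auto
  then show ?case
    using assms[of i f] Query.IH(1)[of "fix_coord i False f"] Query.IH(2)[of "fix_coord i True f"]
    by simp
qed simp

text \<open>At the leaf the loss is the influence of \<open>j\<close>; each query above it halves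
  the loss, which produces the denominator of the score.\<close>

lemma leaf_avg_total_influence_expand_leaf:
  "q \<in> leaves T \<Longrightarrow> j < n \<Longrightarrow>
    leaf_avg (total_influence n) (expand_leaf T q j) f =
    leaf_avg (total_influence n) T f - score n f q j"
proof (induction T arbitrary: q f)
  case (Leaf a)
  then show ?case by (simp add: avg_total_influence_fix_coord score_def)
next
  case (Query i l r)
  have *: "score n f ((i, b) # p) j = score n (fix_coord i b f) p j / 2" for b p
    unfolding score_def restrict_path_Cons by simp
  show ?case using Query by (auto simp: * diff_divide_distrib add_divide_distrib)
qed

lemma dt_vars_expand_leaf: "dt_vars (expand_leaf T q j) \<subseteq> insert j (dt_vars T)"
  by (induction T q j rule: expand_leaf.induct) auto

lemma dt_size_expand_leaf: "q \<in> leaves T \<Longrightarrow> dt_size (expand_leaf T q j) = Suc (dt_size T)"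
  by (induction T q j rule: expand_leaf.induct) auto

lemma read_once_expand_leaf:
  "read_once T \<Longrightarrow> q \<in> leaves T \<Longrightarrow> j \<notin> fst ` set q \<Longrightarrow> read_once (expand_leaf T q j)"
proof (induction T q j rule: expand_leaf.induct)
  case (3 i l r q p j)
  then show ?case
    using dt_vars_expand_leaf[of l p j] dt_vars_expand_leaf[of r p j] by auto
qed auto

section \<open>Error of the completion\<close>

lemma dt_eval_upd: "i \<notin> dt_vars T \<Longrightarrow> dt_eval T (x(i := b)) = dt_eval T x"
  by (induction T) auto

lemma dt_vars_label_leaves [simp]: "dt_vars (label_leaves L T) = dt_vars T"
  by (induction T arbitrary: L) auto

lemma dt_size_completion [simp]: "dt_size (completion n f T) = dt_size T"
proof -
  have "dt_size (label_leaves L T) = dt_size T" for L :: "path \<Rightarrow> real"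
    by (induction T arbitrary: L) auto
  then show ?thesis by (simp add: completion_def)
qed

lemma completion_Query:
  "completion n f (Query i l r) =
    Query i (completion n (fix_coord i False f) l) (completion n (fix_coord i True f) r)"
  by (simp add: completion_def fix_coord_def)

lemma completion_error:
  "read_once T \<Longrightarrow> dt_vars T \<subseteq> {..<n} \<Longrightarrow>
    avg n (\<lambda>x. of_bool (dt_eval (completion n f T) x \<noteq> f x)) =
    leaf_avg (\<lambda>g. avg n (\<lambda>x. of_bool (sign_pm (avg n g) \<noteq> g x))) T f"
proof (induction T arbitrary: f)
  case (Leaf a)
  then show ?case by (simp add: completion_def expectation_uniform_cube)
next
  case (Query i l r)
  let ?w = "\<lambda>x. of_bool (dt_eval (completion n f (Query i l r)) x \<noteq> f x) :: real"
  have "fix_coord i False ?w = (\<lambda>x. of_bool (dt_eval (completion n (fix_coord i False f) l) x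
      \<noteq> fix_coord i False f x))"
    "fix_coord i True ?w = (\<lambda>x. of_bool (dt_eval (completion n (fix_coord i True f) r) x
      \<noteq> fix_coord i True f x))"
    using Query.prems unfolding completion_Query
    by (simp_all add: fix_coord_def dt_eval_upd completion_def)
  then show ?case
    using Query by (simp add: avg_split[of i n ?w])
qed

text \<open>The better constant label errs with probability
  \<open>(1 - \<bar>\<mu>\<bar>) / 2\<close>, and
  \<open>\<mu>\<^sup>2 \<le> \<bar>\<mu>\<bar>\<close>.\<close>

lemma avg_sign_error_le:
  assumes g: "g \<in> cube n \<rightarrow> {-1, 1}"
  shows "avg n (\<lambda>x. of_bool (sign_pm (avg n g) \<noteq> g x)) \<le> (1 - (avg n g)\<^sup>2) / 2"
proof -
  define \<mu> where "\<mu> = avg n g"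
  have "avg n (\<lambda>x. of_bool (sign_pm \<mu> \<noteq> g x)) = avg n (\<lambda>x. 1 / 2 - sign_pm \<mu> / 2 * g x)"
  proof (rule avg_cong)
    fix x assume "x \<in> cube n"
    with g have "g x \<in> {-1, 1}" by (rule funcset_mem)
    then show "of_bool (sign_pm \<mu> \<noteq> g x) = 1 / 2 - sign_pm \<mu> / 2 * g x"
      by (auto simp: sign_pm_def)
  qed
  also have "\<dots> = 1 / 2 - sign_pm \<mu> / 2 * \<mu>"
    unfolding avg_diff avg_mult avg_const by (simp add: \<mu>_def)
  also have "\<dots> = (1 - \<bar>\<mu>\<bar>) / 2"
    by (simp add: sign_pm_def)
  also have "\<dots> \<le> (1 - \<mu>\<^sup>2) / 2"
  proof -
    have "\<bar>\<mu>\<bar> * \<bar>\<mu>\<bar> \<le> 1 * \<bar>\<mu>\<bar>"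
      by (rule mult_right_mono) (use abs_avg_pm_le_1[OF g] in \<open>simp_all add: \<mu>_def\<close>)
    then show ?thesis by (simp add: power2_eq_square)
  qed
  finally show ?thesis by (simp add: \<mu>_def)
qed

definition leaf_variance :: "nat \<Rightarrow> ((nat \<Rightarrow> bool) \<Rightarrow> real) \<Rightarrow> 'a dtree \<Rightarrow> real" where
  "leaf_variance n f T = leaf_avg (\<lambda>g. 1 - (avg n g)\<^sup>2) T f"

lemma completion_error_le:
  assumes f: "f \<in> cube n \<rightarrow> {-1, 1}" and T: "read_once T" "dt_vars T \<subseteq> {..<n}"
  shows "avg n (\<lambda>x. of_bool (dt_eval (completion n f T) x \<noteq> f x)) \<le> leaf_variance n f T / 2"
proof -
  have "leaf_avg (\<lambda>g. avg n (\<lambda>x. of_bool (sign_pm (avg n g) \<noteq> g x))) T f \<le>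
      leaf_avg (\<lambda>g. (1 / 2) * (1 - (avg n g)\<^sup>2) + 0 * (1 - (avg n g)\<^sup>2)) T f"
  proof (rule leaf_avg_mono)
    fix p assume "p \<in> leaves T"
    then have "restrict_path f p \<in> cube n \<rightarrow> {-1, 1}"
      using restrict_path_pm[OF f] leaves_vars[of p T] T(2) by blast
    then show "avg n (\<lambda>x. of_bool (sign_pm (avg n (restrict_path f p)) \<noteq> restrict_path f p x)) \<le>
        (1 / 2) * (1 - (avg n (restrict_path f p))\<^sup>2) + 0 * (1 - (avg n (restrict_path f p))\<^sup>2)"
      using avg_sign_error_le by simp
  qed
  then show ?thesis
    unfolding leaf_avg_linear completion_error[OF T] leaf_variance_def by simp
qed

section \<open>Score and cost against the leaf variance\<close>

text \<open>A score bound \<sigma> bounds the influences at a leaf \<open>p\<close> by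
  \<open>\<sigma> * 2 ^ length p\<close>. The OSSS bound applies there with the same
  \<open>s\<close>, and the powers of 2 cancel in the average.\<close>

lemma leaf_variance_le:
  assumes f: "f \<in> cube n \<rightarrow> {-1, 1}" "dt_complexity_le n s f"
    and T: "dt_vars T \<subseteq> {..<n}"
    and \<sigma>: "\<And>p i. p \<in> leaves T \<Longrightarrow> i < n \<Longrightarrow> score n f p i \<le> \<sigma>" "0 \<le> \<sigma>"
  shows "leaf_variance n f T \<le> \<sigma> * log 2 (real s) * real (dt_size T)"
  unfolding leaf_variance_def
proof (rule leaf_avg_le_size)
  fix p assume p: "p \<in> leaves T"
  then have vars: "fst ` set p \<subseteq> {..<n}"
    using leaves_vars[of p T] T by blast
  have "influence n i (restrict_path f p) \<le> \<sigma> * 2 ^ length p" if "i < n" for i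
    using \<sigma>(1)[OF p that] by (simp add: score_def field_simps)
  then have "1 - (avg n (restrict_path f p))\<^sup>2 \<le> \<sigma> * 2 ^ length p * log 2 (real s)"
    using f vars \<sigma>(2)
    by (intro variance_le_max_influence restrict_path_pm dt_complexity_le_restrict_path) auto
  then show "1 - (avg n (restrict_path f p))\<^sup>2 \<le> \<sigma> * log 2 (real s) * 2 ^ length p"
    by (simp add: mult_ac)
qed

lemma leaf_total_influence_le:
  assumes f: "f \<in> cube n \<rightarrow> {-1, 1}" "dt_complexity_le n s f"
    and T: "dt_vars T \<subseteq> {..<n}"
  shows "leaf_avg (total_influence n) T f \<le> d * leaf_variance n f T + 4 * 2 powr (- d) * real s"
proof -
  let ?R = "\<lambda>g. avg n (\<lambda>x. 2 ^ sens n g x)"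
  have "leaf_avg (total_influence n) T f \<le>
      leaf_avg (\<lambda>g. d * (1 - (avg n g)\<^sup>2) + 4 * 2 powr (- d) * ?R g) T f"
  proof (rule leaf_avg_mono)
    fix p assume "p \<in> leaves T"
    then have "restrict_path f p \<in> cube n \<rightarrow> {-1, 1}"
      using restrict_path_pm[OF f(1)] leaves_vars[of p T] T by blast
    then show "total_influence n (restrict_path f p) \<le>
        d * (1 - (avg n (restrict_path f p))\<^sup>2) + 4 * 2 powr (- d) * ?R (restrict_path f p)"
      by (rule total_influence_le_variance_add)
  qed
  also have "\<dots> = d * leaf_variance n f T + 4 * 2 powr (- d) * leaf_avg ?R T f"
    unfolding leaf_avg_linear leaf_variance_def ..
  also have "leaf_avg ?R T f \<le> ?R f"
    by (rule leaf_avg_superharmonic[OF avg_exp_sens_fix_coord_le T])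
  also have "?R f \<le> real s"
    by (rule avg_exp_sens_le_dt_complexity[OF f(2)])
  finally show ?thesis by simp
qed

section \<open>Runs of the algorithm\<close>

text \<open>\<open>ln m\<close> grows by at most \<open>1 / m\<close>, while \<open>ln y\<close>
  falls by at least the relative decrease of \<open>y\<close>; both follow from
  \<open>ln z \<le> z - 1\<close>.\<close>

lemma potential_decrease:
  assumes "0 < y'" "0 < y" "0 < m" "0 \<le> L" and le: "y \<le> L * m * (y - y')"
  shows "L * ln y' + ln (m + 1) \<le> L * ln y + ln (m :: real)"
proof -
  have "ln (m + 1) - ln m \<le> 1 / m"
    using ln_le_minus_one[of "(m + 1) / m"] assms(3) by (simp add: ln_div field_simps)
  also have "\<dots> \<le> L * ((y - y') / y)"
    using le assms(2,3) by (simp add: field_simps)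
  also have "\<dots> \<le> L * (ln y - ln y')"
    using ln_le_minus_one[of "y' / y"] assms(1,2,4)
    by (intro mult_left_mono) (simp_all add: ln_div diff_divide_distrib)
  finally show ?thesis by (simp add: algebra_simps)
qed

lemma score_le_arg_max:
  assumes "\<forall>p\<in>leaves T. is_arg_max (\<lambda>i. influence n i (restrict_path f p)) (\<lambda>i. i < n) (v p)"
    and "is_arg_max (\<lambda>p. score n f p (v p)) (\<lambda>p. p \<in> leaves T) q"
    and "p \<in> leaves T" "i < n"
  shows "score n f p i \<le> score n f q (v q)"
proof -
  have "influence n i (restrict_path f p) \<le> influence n (v p) (restrict_path f p)"
    using assms(1,3,4) by (auto simp: is_arg_max_linorder)
  then have "score n f p i \<le> score n f p (v p)"
    by (simp add: score_def divide_right_mono)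
  also have "\<dots> \<le> score n f q (v q)"
    using assms(2,3) by (auto simp: is_arg_max_linorder)
  finally show ?thesis .
qed

lemma is_approximation_completion:
  assumes "f \<in> cube n \<rightarrow> {-1, 1}" "read_once T" "dt_vars T \<subseteq> {..<n}"
    and "leaf_variance n f T \<le> 2 * \<epsilon>"
  shows "is_approximation n \<epsilon> f (completion n f T)"
  using completion_error_le[OF assms(1-3)] assms(4)
  by (simp add: is_approximation_def prob_uniform_cube)

lemma ex_is_arg_max:
  fixes g :: "'a \<Rightarrow> 'b :: linorder"
  assumes "finite A" "A \<noteq> {}"
  shows "\<exists>x. is_arg_max g (\<lambda>x. x \<in> A) x"
proof -
  have "Max (g ` A) \<in> g ` A"
    using assms by (intro Max_in) auto
  then obtain x where "x \<in> A" "Max (g ` A) = g x"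
    by blast
  then have "is_arg_max g (\<lambda>x. x \<in> A) x"
    using Max_ge[of "g ` A"] assms by (force simp: is_arg_max_linorder)
  then show ?thesis ..
qed

text \<open>Finite nonempty sets have maximisers, so only \<open>n = 0\<close>, where no variable
  exists, could block a step.\<close>

lemma top_down_step_exists:
  assumes f: "f \<in> cube n \<rightarrow> {-1, 1}" "dt_complexity_le n s f"
    and T: "read_once T" "dt_vars T \<subseteq> {..<n}"
    and "0 \<le> \<epsilon>" "\<not> is_approximation n \<epsilon> f (completion n f T)"
  shows "\<exists>T'. top_down_step n f \<epsilon> T T'"
proof -
  have "n \<noteq> 0"
  proof
    assume "n = 0"
    \<comment> \<open>Without variables every score bound holds vacuously, in particular 0.\<close>
    then have "leaf_variance n f T \<le> 0"
      using leaf_variance_le[OF f T(2), of 0] by simp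
    then show False
      using is_approximation_completion[OF f(1) T, of \<epsilon>] assms(5,6) by simp
  qed
  then have "\<exists>i. is_arg_max (\<lambda>i. influence n i (restrict_path f p)) (\<lambda>i. i \<in> {..<n}) i" for p
    by (intro ex_is_arg_max) auto
  then obtain v where "\<And>p. is_arg_max (\<lambda>i. influence n i (restrict_path f p)) (\<lambda>i. i < n) (v p)"
    unfolding lessThan_iff by metis
  moreover obtain q where "is_arg_max (\<lambda>p. score n f p (v p)) (\<lambda>p. p \<in> leaves T) q"
    using ex_is_arg_max[OF finite_leaves leaves_nonempty] by blast
  ultimately show ?thesis
    using assms(6) unfolding top_down_step_def by blast
qed

text \<open>The offset makes the two lower bounds on the leaf variance, \<open>2\<epsilon>\<close> and
  \<open>leaf_avg (total_influence n) T f / (3d)\<close>, into a single bound proportional to the potential.\<close>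

definition potential :: "nat \<Rightarrow> ((nat \<Rightarrow> bool) \<Rightarrow> real) \<Rightarrow> real \<Rightarrow> real \<Rightarrow> 'a dtree \<Rightarrow> real" where
  "potential n f d \<epsilon> T = leaf_avg (total_influence n) T f + 6 * d * \<epsilon>"

lemma potential_pos: "0 < d \<Longrightarrow> 0 < \<epsilon> \<Longrightarrow> 6 * d * \<epsilon> \<le> potential n f d \<epsilon> T \<and> 0 < potential n f d \<epsilon> T"
  using leaf_avg_nonneg[of "total_influence n" T f]
  by (simp add: potential_def total_influence_nonneg add_nonneg_pos)

lemma potential_le_score:
  assumes f: "f \<in> cube n \<rightarrow> {-1, 1}" "dt_complexity_le n s f"
    and T: "read_once T" "dt_vars T \<subseteq> {..<n}"
    and \<epsilon>: "0 < \<epsilon>" "\<epsilon> < 1 / 2" and d: "d = log 2 (real s / \<epsilon>)" "1 \<le> d"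
    and not_approx: "\<not> is_approximation n \<epsilon> f (completion n f T)"
    and \<sigma>: "\<And>p i. p \<in> leaves T \<Longrightarrow> i < n \<Longrightarrow> score n f p i \<le> \<sigma>" "0 \<le> \<sigma>"
  shows "potential n f d \<epsilon> T \<le> 6 * d * log 2 (real s) * real (dt_size T) * \<sigma>"
proof -
  let ?V = "leaf_variance n f T"
  have s: "0 < s" using f(2) by (rule dt_complexity_le_pos)
  have V: "2 * \<epsilon> < ?V"
    using is_approximation_completion[OF f(1) T] not_approx by force
  \<comment> \<open>The threshold \<open>d\<close> is chosen so that the tail term becomes
    \<open>4 * \<epsilon>\<close>.\<close>
  have "2 powr (- d) * real s = \<epsilon>"
    using s \<epsilon> unfolding d(1) by (simp add: powr_minus)
  then have "leaf_avg (total_influence n) T f \<le> d * ?V + 4 * \<epsilon>"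
    using leaf_total_influence_le[OF f T(2), of d] by simp
  also have "\<dots> \<le> d * ?V + 2 * ?V"
    using V by simp
  also have "\<dots> \<le> 3 * (d * ?V)"
    using mult_right_mono[OF d(2), of ?V] V \<epsilon> by simp
  finally have "leaf_avg (total_influence n) T f \<le> 3 * (d * ?V)" .
  \<comment> \<open>Three times this bounds the offset, so cost and offset are at most
    \<open>3 * d * ?V\<close> each.\<close>
  moreover have "d * (2 * \<epsilon>) \<le> d * ?V"
    using V d(2) by (intro mult_left_mono) auto
  ultimately have "potential n f d \<epsilon> T \<le> 6 * d * ?V"
    by (simp add: potential_def)
  also have "\<dots> \<le> 6 * d * (\<sigma> * log 2 (real s) * real (dt_size T))"
    using leaf_variance_le[OF f T(2) \<sigma>] d(2) by (intro mult_left_mono) auto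
  finally show ?thesis by (simp add: mult_ac)
qed

lemma one_le_log_ratio:
  assumes "0 < s" "0 < \<epsilon>" "\<epsilon> < 1 / 2"
  shows "1 \<le> log 2 (real s / \<epsilon>)"
proof -
  have "2 \<le> real s / \<epsilon>"
    using assms by (simp add: field_simps)
  then show ?thesis
    using log_le_cancel_iff[of 2 2 "real s / \<epsilon>"] by simp
qed

text \<open>Growth of the logarithm of the size is paid for by \<open>L\<close> times the fall of
  the logarithm of the potential. The two structural conjuncts are what the score bound needs at the
  next step.\<close>

lemma reachable_invariant:
  assumes f: "f \<in> cube n \<rightarrow> {-1, 1}" "dt_complexity_le n s f"
    and \<epsilon>: "0 < \<epsilon>" "\<epsilon> < 1 / 2" and d: "d = log 2 (real s / \<epsilon>)" "1 \<le> d"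
    and L: "L = 6 * d * log 2 (real s)"
    and reach: "(top_down_step n f \<epsilon>)\<^sup>*\<^sup>* (Leaf ()) T"
  shows "read_once T \<and> dt_vars T \<subseteq> {..<n} \<and>
    L * ln (potential n f d \<epsilon> T) + ln (real (dt_size T)) \<le> L * ln (potential n f d \<epsilon> (Leaf ()))"
  using reach
proof (induction rule: rtranclp_induct)
  case base
  then show ?case by simp
next
  case (step T T')
  then have T: "read_once T" "dt_vars T \<subseteq> {..<n}" by auto
  obtain v q where not_approx: "\<not> is_approximation n \<epsilon> f (completion n f T)"
    and v: "\<forall>p\<in>leaves T. is_arg_max (\<lambda>i. influence n i (restrict_path f p)) (\<lambda>i. i < n) (v p)"
    and q: "is_arg_max (\<lambda>p. score n f p (v p)) (\<lambda>p. p \<in> leaves T) q"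
    and T': "T' = expand_leaf T q (v q)"
    using step.hyps(2) unfolding top_down_step_def by blast
  let ?\<Phi> = "potential n f d \<epsilon>" and ?\<sigma> = "score n f q (v q)"
  have q_leaf: "q \<in> leaves T" and vq: "v q < n"
    using v q by (auto simp: is_arg_max_def)
  have \<sigma>_nonneg: "0 \<le> ?\<sigma>"
    by (simp add: score_def influence_nonneg)
  have pos: "0 < ?\<Phi> U" for U :: bare_tree
    using potential_pos d(2) \<epsilon>(1) by (metis less_le_trans zero_less_one)
  have L_nonneg: "0 \<le> L"
    using d(2) dt_complexity_le_pos[OF f(2)] by (simp add: L)
  have bound: "?\<Phi> T \<le> L * real (dt_size T) * ?\<sigma>"
    unfolding L
    by (rule potential_le_score[OF f T \<epsilon> d not_approx score_le_arg_max[OF v q] \<sigma>_nonneg])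
  \<comment> \<open>The potential is positive, so \<open>bound\<close> forces a nonzero score,
    whereas a repeated query would score 0.\<close>
  have "v q \<notin> fst ` set q"
  proof
    assume "v q \<in> fst ` set q"
    then have "?\<sigma> = 0"
      by (simp add: score_def influence_restrict_path_queried)
    then show False using bound pos[of T] by simp
  qed
  then have "read_once T'"
    using T q_leaf by (simp add: T' read_once_expand_leaf)
  moreover have "dt_vars T' \<subseteq> {..<n}"
    using dt_vars_expand_leaf[of T q "v q"] T vq by (auto simp: T')
  moreover have "?\<Phi> T' = ?\<Phi> T - ?\<sigma>"
    using leaf_avg_total_influence_expand_leaf[OF q_leaf vq] by (simp add: potential_def T')
  then have "L * ln (?\<Phi> T') + ln (real (dt_size T) + 1) \<le> L * ln (?\<Phi> T) + ln (real (dt_size T))"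
    using bound dt_size_pos[of T] L_nonneg
    by (intro potential_decrease[OF pos[of T'] pos[of T]]) auto
  moreover have "real (dt_size T') = real (dt_size T) + 1"
    using q_leaf by (simp add: T' dt_size_expand_leaf)
  ultimately show ?case using step.IH by simp
qed

text \<open>The potential starts at or below \<open>6 * d\<close> and never falls below
  \<open>6 * d * \<epsilon>\<close>. The bound covers every reachable tree, so it also serves for
  termination.\<close>

lemma dt_size_reachable_le:
  assumes f: "f \<in> cube n \<rightarrow> {-1, 1}" "dt_complexity_le n s f"
    and \<epsilon>: "0 < \<epsilon>" "\<epsilon> < 1 / 2"
    and reach: "(top_down_step n f \<epsilon>)\<^sup>*\<^sup>* (Leaf ()) T"
  shows "real (dt_size T) \<le> real s powr (6 * (log 2 (real s / \<epsilon>) * log 2 (1 / \<epsilon>)))"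
proof -
  define d where "d = log 2 (real s / \<epsilon>)"
  define L where "L = 6 * d * log 2 (real s)"
  let ?\<Phi> = "potential n f d \<epsilon>"
  have s: "1 \<le> real s" using dt_complexity_le_pos[OF f(2)] by simp
  have d1: "1 \<le> d"
    unfolding d_def by (rule one_le_log_ratio[OF dt_complexity_le_pos[OF f(2)] \<epsilon>])
  have L0: "0 \<le> L"
    using d1 s by (simp add: L_def)
  have "2 powr (- d) * real s = \<epsilon>"
    using s \<epsilon> unfolding d_def by (simp add: powr_minus)
  then have "total_influence n f \<le> d * (1 - (avg n f)\<^sup>2) + 4 * \<epsilon>"
    using leaf_total_influence_le[OF f, of "Leaf ()" d] by (simp add: leaf_variance_def)
  \<comment> \<open>The variance is at most 1, and
    \<open>4 * \<epsilon> \<le> 2 \<le> 2 * d\<close>.\<close>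
  also have "\<dots> \<le> d * 1 + 2 * d"
    using d1 \<epsilon> by (intro add_mono mult_left_mono) auto
  finally have "total_influence n f \<le> 3 * d"
    by simp
  moreover have "d * (2 * \<epsilon>) \<le> d * 1"
    using d1 \<epsilon> by (intro mult_left_mono) auto
  ultimately have "total_influence n f + 6 * d * \<epsilon> \<le> 6 * d"
    by simp
  then have "ln (?\<Phi> (Leaf ())) \<le> ln (6 * d)"
    using potential_pos[of d \<epsilon> n f "Leaf ()"] d1 \<epsilon> by (simp add: potential_def)
  moreover have "ln (6 * d * \<epsilon>) \<le> ln (?\<Phi> T)"
    using potential_pos[of d \<epsilon> n f T] d1 \<epsilon> by simp
  ultimately have "ln (?\<Phi> (Leaf ())) - ln (?\<Phi> T) \<le> ln (1 / \<epsilon>)"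
    using d1 \<epsilon> by (simp add: ln_mult ln_div)
  then have "L * (ln (?\<Phi> (Leaf ())) - ln (?\<Phi> T)) \<le> L * ln (1 / \<epsilon>)"
    using L0 by (rule mult_left_mono)
  then have "ln (real (dt_size T)) \<le> L * ln (1 / \<epsilon>)"
    using reachable_invariant[OF f \<epsilon> d_def d1 L_def reach] by (simp add: algebra_simps)
  \<comment> \<open>The factor \<open>1 / ln 2\<close> moves from the logarithm of \<open>s\<close>
    to that of \<open>1 / \<epsilon>\<close>.\<close>
  also have "\<dots> = 6 * (d * log 2 (1 / \<epsilon>)) * ln (real s)"
    by (simp add: L_def log_def)
  finally have "real (dt_size T) \<le> exp (6 * (d * log 2 (1 / \<epsilon>)) * ln (real s))"
    using dt_size_pos[of T] by (metis exp_le_cancel_iff exp_ln of_nat_0_less_iff)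
  then show ?thesis
    using s by (simp add: powr_def d_def)
qed

text \<open>Every step adds one leaf, so the size bound excludes infinite runs.\<close>

lemma top_down_terminates_if_dt_complexity_le:
  assumes f: "f \<in> cube n \<rightarrow> {-1, 1}" "dt_complexity_le n s f"
    and \<epsilon>: "0 < \<epsilon>" "\<epsilon> < 1 / 2"
  shows "top_down_terminates n f \<epsilon>"
  unfolding top_down_terminates_def
proof (intro conjI allI impI)
  define B where "B = real s powr (6 * (log 2 (real s / \<epsilon>) * log 2 (1 / \<epsilon>)))"
  show "\<nexists>R. R 0 = Leaf () \<and> (\<forall>t. top_down_step n f \<epsilon> (R t) (R (Suc t)))"
  proof
    assume "\<exists>R. R 0 = Leaf () \<and> (\<forall>t. top_down_step n f \<epsilon> (R t) (R (Suc t)))"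
    then obtain R where R: "R 0 = Leaf ()" "\<And>t. top_down_step n f \<epsilon> (R t) (R (Suc t))"
      by blast
    have step_size: "dt_size T' = Suc (dt_size T)" if "top_down_step n f \<epsilon> T T'" for T T'
      using that by (auto simp: top_down_step_def is_arg_max_def dt_size_expand_leaf)
    have "(top_down_step n f \<epsilon>)\<^sup>*\<^sup>* (Leaf ()) (R t) \<and> dt_size (R t) = Suc t" for t
    proof (induction t)
      case (Suc t)
      then show ?case using R(2)[of t] step_size[OF R(2)[of t]] by auto
    qed (simp add: R(1))
    then have le_B: "real (Suc t) \<le> B" for t
      using dt_size_reachable_le[OF f \<epsilon>, of "R t"] by (simp add: B_def)
    obtain t where "B < real t"
      using reals_Archimedean2 by blast
    then show False
      using le_B[of t] by simp
  qed
next
  fix T assume reach: "(top_down_step n f \<epsilon>)\<^sup>*\<^sup>* (Leaf ()) T"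
  have "1 \<le> log 2 (real s / \<epsilon>)"
    by (rule one_le_log_ratio[OF dt_complexity_le_pos[OF f(2)] \<epsilon>])
  then have "read_once T" "dt_vars T \<subseteq> {..<n}"
    using reachable_invariant[OF f \<epsilon> refl _ refl reach] by auto
  then show "is_approximation n \<epsilon> f (completion n f T) \<or> (\<exists>T'. top_down_step n f \<epsilon> T T')"
    using top_down_step_exists[OF f] \<epsilon>(1) by (meson less_imp_le)
qed

theorem theorem2p1:
  "\<exists>C::real. C > 0 \<and>
     (\<forall>(n::nat) (s::nat) (\<epsilon>::real) (f :: (nat \<Rightarrow> bool) \<Rightarrow> real).
        0 < \<epsilon> \<and> \<epsilon> < 1/2 \<and> f \<in> cube n \<rightarrow> {-1, 1} \<and> computable_by_dt_of_size n f s \<longrightarrow>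
        top_down_terminates n f \<epsilon> \<and>
        (\<forall>m\<in>top_down_dt_sizes n f \<epsilon>.
           real m \<le> real s powr (C * (log 2 (real s / \<epsilon>) * log 2 (1 / \<epsilon>)))))"
proof (intro exI[of _ 6] conjI allI impI ballI; (elim conjE)?)
  fix n s m :: nat and \<epsilon> :: real and f :: "(nat \<Rightarrow> bool) \<Rightarrow> real"
  assume \<epsilon>: "0 < \<epsilon>" "\<epsilon> < 1 / 2" and f: "f \<in> cube n \<rightarrow> {-1, 1}"
    and "computable_by_dt_of_size n f s"
  then have s: "dt_complexity_le n s f"
    by (simp add: computable_imp_dt_complexity_le)
  show "top_down_terminates n f \<epsilon>"
    by (rule top_down_terminates_if_dt_complexity_le[OF f s \<epsilon>])
  assume "m \<in> top_down_dt_sizes n f \<epsilon>"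
  then obtain T where "(top_down_step n f \<epsilon>)\<^sup>*\<^sup>* (Leaf ()) T" "m = dt_size T"
    by (auto simp: top_down_dt_sizes_def top_down_output_def)
  then show "real m \<le> real s powr (6 * (log 2 (real s / \<epsilon>) * log 2 (1 / \<epsilon>)))"
    using dt_size_reachable_le[OF f s \<epsilon>] by simp
qed simp

end
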